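(* If $n\geq 5$ and $n\equiv 1, 3,$ or $7 \pmod 8$, then $K_n^*$ admits a $(\vec{C}_2,\ldots,\vec{C}_2,\vec{C}_3)$-factorization.
   Context: $K_n^*$ denotes the complete symmetric digraph on $n$ vertices (for every ordered pair of distinct vertices $(u,v)$ there is exactly one arc from $u$ to $v$). $\vec{C}_m$ denotes a directed cycle of length $m$ ($\vec{C}_2$ on $u,v$ is the pair of arcs $(u,v),(v,u)$). For odd $n$, a $(\vec{C}_2,\ldots,\vec{C}_2,\vec{C}_3)$-factor of $K_n^*$ is a spanning subdigraph consisting of $(n-3)/2$ directed 2-cycles and one directed 3-cycle, all pairwise vertex-disjoint; a $(\vec{C}_2,\ldots,\vec{C}_2,\vec{C}_3)$-factorization of $K_n^*$ is a partition of its arc set into such factors. *)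

theory Defs
  imports "Graph_Theory.Graph_Theory" "HOL-Library.Disjoint_Sets"
begin

text \<open>
  The complete symmetric digraph on \<open>n\<close> vertices is \<^const>\<open>complete_digraph\<close>: a finite loopfree
  digraph without parallel arcs in which every ordered pair of distinct vertices is joined by an
  arc.
\<close>

text \<open>
  \<open>directed_cycle m C\<close>: the digraph \<open>C\<close> is a directed cycle of length \<open>m\<close>, i.e. it consists of
  precisely the vertices and arcs of a closed walk of length \<open>m\<close> without repeated vertices.
  The case \<open>m = 1\<close> is a loop, and \<open>m = 2\<close> a pair of opposite arcs.
\<close>

definition directed_cycle :: "nat \<Rightarrow> ('a,'b) pre_digraph \<Rightarrow> bool" where
  "directed_cycle m C \<longleftrightarrow>
     (\<exists>p. pre_digraph.cycle C p \<and> length p = m \<and> arcs C = set p \<and> verts C = tail C ` set p)"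

text \<open>
  The list \<open>ms\<close> gives the cycle lengths with multiplicity. \<open>pre_digraph.Union G\<close> is the union of
  subdigraphs of \<open>G\<close>; the argument \<open>G\<close> only supplies the tail and head maps.
\<close>

definition cycle_factor :: "nat list \<Rightarrow> ('a,'b) pre_digraph \<Rightarrow> ('a,'b) pre_digraph \<Rightarrow> bool" where
  "cycle_factor ms F G \<longleftrightarrow> spanning F G \<and>
     (\<exists>Cs. list_all2 directed_cycle ms Cs \<and>
           (\<forall>C\<in>set Cs. subgraph C G) \<and>
           (\<forall>i<length Cs. \<forall>j<length Cs. i \<noteq> j \<longrightarrow> verts (Cs ! i) \<inter> verts (Cs ! j) = {}) \<and>
           F = pre_digraph.Union G (set Cs))"

text \<open>
  A spanning subdigraph of \<open>G\<close> is determined by its arc set, so passing to the set of arc sets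
  does not identify distinct factors.
\<close>

definition cycle_factorization ::
    "nat list \<Rightarrow> ('a,'b) pre_digraph set \<Rightarrow> ('a,'b) pre_digraph \<Rightarrow> bool" where
  "cycle_factorization ms \<F> G \<longleftrightarrow>
     (\<forall>F\<in>\<F>. cycle_factor ms F G) \<and> partition_on (arcs G) (arcs ` \<F>)"

end

theory Submission
  imports Defs
begin

text \<open>
  For \<open>n = 2 k + 1\<close> with \<open>k\<close> congruent to 0 or 1 modulo 4, let the integers modulo \<open>2 k\<close> act by
  rotation, fixing one further vertex \<open>\<infinity>\<close>. A factor with triangle \<open>\<infinity>, 0, k\<close> whose 2-cycles use each
  difference other than \<open>0\<close> and \<open>k\<close> exactly once is a base factor: its rotations form a
  factorization. Such a factor is a cyclic analogue of a Rosa sequence.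

  For \<open>n\<close> congruent to 7 modulo 8 one doubles a factorization on an odd set \<open>A\<close> with
  \<open>m = (n - 1) / 2\<close> elements. Let \<open>B\<close> have \<open>m + 1\<close> elements. The \<open>m - 1\<close> factors on \<open>A\<close> are
  combined with all but one of the \<open>m\<close> one-factors of a one-factorization of \<open>B\<close>. The last
  one-factor \<open>b \<leftrightarrow> b'\<close> provides, for each \<open>b \<in> B\<close>, a triangle \<open>a, b, b'\<close> with a common \<open>a \<in> A\<close>, and the
  remaining arcs between \<open>A\<close> and \<open>B\<close> are grouped into 2-cycles by a cyclic Latin square.
\<close>

section \<open>Factorizations as families of maps\<close>

text \<open>
  A factor is encoded by the map sending each vertex to its out-neighbour. The values of the map
  outside \<open>V\<close> are irrelevant.
\<close>
definition factor_perm :: "'a set \<Rightarrow> ('a \<Rightarrow> 'a) \<Rightarrow> bool" where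
  "factor_perm V p \<longleftrightarrow> (\<exists>a b c. {a, b, c} \<subseteq> V \<and> distinct [a, b, c] \<and> p a = b \<and> p b = c \<and> p c = a \<and>
     (\<forall>v\<in>V - {a, b, c}. p v \<in> V - {a, b, c} \<and> p v \<noteq> v \<and> p (p v) = v))"

definition factorizable :: "'a set \<Rightarrow> bool" where
  "factorizable V \<longleftrightarrow> (\<exists>P. (\<forall>p\<in>P. factor_perm V p) \<and>
     (\<forall>u\<in>V. \<forall>v\<in>V. u \<noteq> v \<longrightarrow> (\<exists>!p. p \<in> P \<and> p u = v)))"

lemma factorizableI:
  assumes "\<And>i. i \<in> I \<Longrightarrow> factor_perm V (p i)"
    and "\<And>u v. u \<in> V \<Longrightarrow> v \<in> V \<Longrightarrow> u \<noteq> v \<Longrightarrow> \<exists>!i. i \<in> I \<and> p i u = v"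
  shows "factorizable V"
  unfolding factorizable_def
proof (intro exI[of _ "p ` I"] conjI ballI impI)
  fix u v assume "u \<in> V" "v \<in> V" "u \<noteq> v"
  from assms(2)[OF this] show "\<exists>!q. q \<in> p ` I \<and> q u = v" by auto
qed (use assms(1) in auto)

lemma factor_permI:
  assumes "{a, b, c} \<subseteq> V" "distinct [a, b, c]" "p a = b" "p b = c" "p c = a"
    and "\<And>v. v \<in> V - {a, b, c} \<Longrightarrow> p v \<in> V - {a, b, c} \<and> p v \<noteq> v \<and> p (p v) = v"
  shows "factor_perm V p"
  unfolding factor_perm_def
  by (rule exI[of _ a], rule exI[of _ b], rule exI[of _ c],
      intro conjI[OF assms(1)] conjI[OF assms(2)] conjI[OF assms(3)] conjI[OF assms(4)]
        conjI[OF assms(5)] ballI assms(6))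

lemma factor_permE:
  assumes "factor_perm V p"
  obtains a b c where "{a, b, c} \<subseteq> V" "distinct [a, b, c]" "p a = b" "p b = c" "p c = a"
    and "\<forall>v\<in>V - {a, b, c}. p v \<in> V - {a, b, c} \<and> p v \<noteq> v \<and> p (p v) = v"
  using assms unfolding factor_perm_def by - (elim exE conjE, rule that)

lemma factorizableE:
  assumes "factorizable V"
  obtains P where "\<forall>p\<in>P. factor_perm V p"
    and "\<forall>u\<in>V. \<forall>v\<in>V. u \<noteq> v \<longrightarrow> (\<exists>!p. p \<in> P \<and> p u = v)"
  using assms unfolding factorizable_def by - (elim exE conjE, rule that)

lemma factor_perm_dest:
  assumes "factor_perm V p" "v \<in> V"
  shows "p v \<in> V" "p v \<noteq> v"
proof -
  obtain a b c where abc: "{a, b, c} \<subseteq> V" "distinct [a, b, c]" "p a = b" "p b = c" "p c = a"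
    and inv: "\<forall>v\<in>V - {a, b, c}. p v \<in> V - {a, b, c} \<and> p v \<noteq> v \<and> p (p v) = v"
    by (rule factor_permE[OF assms(1)])
  have "p v \<in> V \<and> p v \<noteq> v"
  proof (cases "v \<in> {a, b, c}")
    case True
    with abc show ?thesis by (elim insertE) auto
  next
    case False
    with inv assms(2) show ?thesis by blast
  qed
  then show "p v \<in> V" "p v \<noteq> v" by simp_all
qed

text \<open>Conjugation by \<open>f\<close> carries factors on \<open>V\<close> to factors on
  \<open>W\<close>. Hence only the cardinality matters, and each construction may choose convenient
  vertices.\<close>

lemma factorizable_bij:
  assumes f: "bij_betw f V W" and V: "factorizable V"
  shows "factorizable W"
proof -
  obtain P where P: "\<forall>p\<in>P. factor_perm V p"
    and ex1: "\<forall>u\<in>V. \<forall>v\<in>V. u \<noteq> v \<longrightarrow> (\<exists>!p. p \<in> P \<and> p u = v)"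
    by (rule factorizableE[OF V])
  define g where "g = inv_into V f"
  have g: "g w \<in> V" "f (g w) = w" if "w \<in> W" for w
    using that f unfolding g_def by (auto simp: bij_betw_def inv_into_into f_inv_into_f)
  have gf: "g (f v) = v" "f v \<in> W" if "v \<in> V" for v
    using that f unfolding g_def by (auto simp: bij_betw_def)
  show ?thesis
  proof (rule factorizableI[of P _ "\<lambda>p w. f (p (g w))"])
    fix p assume "p \<in> P"
    with P have "factor_perm V p" by simp
    then obtain a b c where abc: "{a, b, c} \<subseteq> V" "distinct [a, b, c]"
      "p a = b" "p b = c" "p c = a"
      and inv: "\<forall>v\<in>V - {a, b, c}. p v \<in> V - {a, b, c} \<and> p v \<noteq> v \<and> p (p v) = v"
      by (rule factor_permE)
    show "factor_perm W (\<lambda>w. f (p (g w)))"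
    proof (rule factor_permI[of "f a" "f b" "f c"])
      show "{f a, f b, f c} \<subseteq> W" using abc gf by auto
      show "distinct [f a, f b, f c]"
        using abc(1,2) inj_on_eq_iff[OF bij_betw_imp_inj_on[OF f]] by auto
      show "f (p (g (f a))) = f b" "f (p (g (f b))) = f c" "f (p (g (f c))) = f a"
        using abc gf by auto
      fix w assume w: "w \<in> W - {f a, f b, f c}"
      then have gw: "g w \<in> V - {a, b, c}" using g by auto
      with inv have q: "p (g w) \<in> V - {a, b, c}" "p (g w) \<noteq> g w" "p (p (g w)) = g w" by auto
      have "f (p (g w)) \<noteq> f x" if "x \<in> {a, b, c}" for x
        using q(1) gf(1) that abc(1) by (metis Diff_iff subsetD)
      then have "f (p (g w)) \<in> W - {f a, f b, f c}" using q(1) gf(2) by auto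
      moreover have "f (p (g w)) \<noteq> w" using q(1,2) gf(1) by (metis DiffD1)
      moreover have "f (p (g (f (p (g w))))) = w" using q(1,3) gf(1) g(2) w by auto
      ultimately show "f (p (g w)) \<in> W - {f a, f b, f c} \<and> f (p (g w)) \<noteq> w \<and> f (p (g (f (p (g w))))) = w"
        by blast
    qed
  next
    fix u v assume uv: "u \<in> W" "v \<in> W" "u \<noteq> v"
    then have "g u \<noteq> g v" using g(2) by metis
    with uv have "\<exists>!p. p \<in> P \<and> p (g u) = g v" using ex1 g(1) by blast
    moreover have "f (p (g u)) = v \<longleftrightarrow> p (g u) = g v" if "p \<in> P" for p
      using factor_perm_dest(1)[OF _ g(1)[OF uv(1)]] P that gf g uv by metis
    ultimately show "\<exists>!p. p \<in> P \<and> f (p (g u)) = v" by metis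
  qed
qed

lemma factorizable_card:
  assumes "factorizable V" "finite V" "finite W" "card V = card W"
  shows "factorizable W"
proof -
  obtain f where "bij_betw f V W" using assms(2-4) finite_same_card_bij by blast
  then show ?thesis using assms(1) by (rule factorizable_bij)
qed

section \<open>The cyclic construction\<close>

text \<open>
  Here \<open>None\<close> is the fixed point of the rotation and \<open>Z d\<close> is the tail of the arc of difference
  \<open>d\<close> in the base factor, which contains the triangle \<open>None, 0, k\<close>; \<open>Z 0 = k\<close> encodes that the
  arc leaving \<open>k\<close> ends in \<open>None\<close>. The last assumption says that the arcs of difference \<open>d\<close> and
  \<open>- d\<close> form a 2-cycle.
\<close>
lemma cyclic_factorizable:
  fixes k :: int and Z :: "int \<Rightarrow> int"
  defines "N \<equiv> 2 * k"
  assumes k: "k > 0"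
    and inj: "inj_on Z {0..<N}" and range: "Z ` {0..<N} \<subseteq> {0..<N}"
    and Z0: "Z 0 = k" and Zk: "Z k = 0"
    and opp: "\<And>d. d \<in> {0<..<N} - {k} \<Longrightarrow> Z (N - d) = (Z d + d) mod N"
  shows "factorizable (insert None (Some ` {0..<N}))"
proof -
  have onto: "Z ` {0..<N} = {0..<N}"
    using inj range by (intro endo_inj_surj) auto
  define D where "D = inv_into {0..<N} Z"
  have Z: "Z d \<in> {0..<N} \<and> D (Z d) = d" if "d \<in> {0..<N}" for d
    using that inj range unfolding D_def by (simp add: image_subset_iff)
  have D: "D z \<in> {0..<N} \<and> Z (D z) = z" if "z \<in> {0..<N}" for z
    using that onto unfolding D_def by (metis f_inv_into_f inv_into_into)
  let ?V = "insert None (Some ` {0..<N})"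
  \<comment> \<open>\<open>p i\<close> is the base factor rotated by \<open>i\<close>: the tail
    \<open>y\<close> is rotated back, \<open>D\<close> reads off the difference of the arc leaving
    it, and that difference is added to \<open>y\<close>. Difference 0 stands for the arc to
    \<open>None\<close>.\<close>
  define p where "p i x = (case x of None \<Rightarrow> Some i | Some y \<Rightarrow>
      let d = D ((y - i) mod N) in if d = 0 then None else Some ((y + d) mod N))" for i x
  have N: "N > 0" using k by (simp add: N_def)
  have D0: "D 0 = k" using Z[of k] k by (auto simp: Zk N_def)
  have Dk: "D k = 0" using Z[of 0] k by (auto simp: Z0 N_def)
  have mm: "z mod N \<in> {0..<N}" for z using N by simp
  show ?thesis
  proof (rule factorizableI[of "{0..<N}" _ p])
    fix i assume i: "i \<in> {0..<N}"
    define j where "j = (i + k) mod N"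
    have ji: "(j - i) mod N = k" unfolding j_def using k by (simp add: mod_simps N_def)
    have jV: "j \<in> {0..<N}" "j \<noteq> i" using mm[of "i + k"] ji k by (auto simp: j_def)
    show "factor_perm ?V (p i)"
    proof (rule factor_permI[of None "Some i" "Some j"])
      show "{None, Some i, Some j} \<subseteq> ?V" "distinct [None, Some i, Some j]" using i jV by auto
      show "p i None = Some i" "p i (Some j) = None" by (simp_all add: p_def Let_def ji Dk)
      show "p i (Some i) = Some j" using k by (simp add: p_def D0 j_def)
      fix v assume v: "v \<in> ?V - {None, Some i, Some j}"
      then obtain x where x: "v = Some x" by (cases v) auto
      with v have x: "v = Some x" "x \<in> {0..<N}" "x \<noteq> i" "x \<noteq> j" by auto
      define z where "z = (x - i) mod N"
      define d where "d = D z"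
      define y where "y = (x + d) mod N"
      have z: "z \<in> {0..<N}" unfolding z_def by (rule mm)
      have xz: "x = (i + z) mod N" using x by (simp add: z_def mod_simps)
      have z0: "z \<noteq> 0" using xz x i by auto
      have zk: "z \<noteq> k" using xz x by (auto simp: j_def)
      have d: "d \<in> {0<..<N} - {k}" using D[OF z] Z0 Zk z0 zk unfolding d_def
        by (metis DiffI atLeastLessThan_iff greaterThanLessThan_iff order_le_less singletonD)
      have y: "y \<in> {0..<N}" unfolding y_def by (rule mm)
      \<comment> \<open>The tail \<open>z = Z d\<close> is sent to \<open>z + d\<close>, which
        \<open>opp\<close> identifies as the tail of difference \<open>N - d\<close>; so the arc
        leaving \<open>y\<close> leads back to \<open>x\<close>.\<close>
      have yz: "(y - i) mod N = Z (N - d)"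
        using opp[OF d] D[OF z] by (simp add: y_def xz mod_simps d_def algebra_simps)
      have Dy: "D ((y - i) mod N) = N - d" unfolding yz using Z[of "N - d"] d by auto
      have pv: "p i (Some x) = Some y" using d by (simp add: p_def Let_def y_def flip: z_def d_def)
      have yx: "(y + (N - d)) mod N = x" using x by (simp add: y_def mod_simps)
      have "y \<noteq> i" using Dy d D0 by (auto simp: N_def)
      moreover have "y \<noteq> j" using Dy d Dk ji by auto
      moreover have "y \<noteq> x"
      proof
        assume "y = x"
        then have "N - d = d" using Dy by (simp add: d_def z_def)
        then show False using d by (simp add: N_def)
      qed
      moreover have "p i (Some y) = Some x" using d Dy yx by (simp add: p_def Let_def)
      ultimately show "p i v \<in> ?V - {None, Some i, Some j} \<and> p i v \<noteq> v \<and> p i (p i v) = v"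
        using y by (auto simp: pv x(1))
    qed
  next
    fix u v assume uv: "u \<in> ?V" "v \<in> ?V" "u \<noteq> v"
    show "\<exists>!i. i \<in> {0..<N} \<and> p i u = v"
    proof (cases u)
      case None
      then show ?thesis using uv by (auto simp: p_def)
    next
      case (Some x)
      then have x: "x \<in> {0..<N}" using uv by auto
      \<comment> \<open>The difference of the arc from \<open>u\<close> to \<open>v\<close>, with
        the code 0 for \<open>v = None\<close>. Its only tail in the base factor is
        \<open>Z d\<close>, which fixes the rotation as \<open>x - Z d\<close>.\<close>
      define d where "d = (case v of None \<Rightarrow> 0 | Some y \<Rightarrow> (y - x) mod N)"
      have d: "d \<in> {0..<N}" using N by (auto simp: d_def split: option.split)
      have "p i u = v \<longleftrightarrow> D ((x - i) mod N) = d" if "i \<in> {0..<N}" for i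
      proof (cases v)
        case None
        then show ?thesis by (simp add: Some p_def Let_def d_def)
      next
        case (Some y)
        have y: "y \<in> {0..<N}" "y \<noteq> x" using uv Some \<open>u = Some x\<close> by auto
        define e where "e = D ((x - i) mod N)"
        have e: "e \<in> {0..<N}" using D[OF mm] by (simp add: e_def)
        have xd: "(x + d) mod N = y" using y by (simp add: d_def Some mod_simps)
        then have "d \<noteq> 0" using x y by auto
        moreover have "(x + e) mod N = y \<longleftrightarrow> e = d"
        proof
          assume "(x + e) mod N = y"
          then show "e = d" using e by (auto simp: d_def Some mod_simps)
        next
          assume "e = d"
          then show "(x + e) mod N = y" using xd by simp
        qed
        ultimately show ?thesis
          by (auto simp: p_def \<open>u = Some x\<close> Let_def Some simp flip: e_def)
      qed
      moreover have "D ((x - i) mod N) = d \<longleftrightarrow> i = (x - Z d) mod N" if "i \<in> {0..<N}" for i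
      proof
        assume "D ((x - i) mod N) = d"
        then have "Z d = (x - i) mod N" using D[OF mm] by auto
        then show "i = (x - Z d) mod N" using that by (simp add: mod_simps)
      next
        assume "i = (x - Z d) mod N"
        then have "(x - i) mod N = Z d" using Z[OF d] by (simp add: mod_simps)
        then show "D ((x - i) mod N) = d" using Z[OF d] by simp
      qed
      ultimately have "i \<in> {0..<N} \<and> p i u = v \<longleftrightarrow> i = (x - Z d) mod N" for i
        using mm by metis
      then show ?thesis by simp
    qed
  qed
qed

text \<open>
  The starter: the pairs \<open>{half d, half d + d}\<close>, \<open>0 < d < k\<close>, partition the residues
  modulo \<open>2 k\<close> other than \<open>0\<close> and \<open>k\<close>. Even differences \<open>2 j\<close> are nested around \<open>0\<close> for
  \<open>j < s\<close> and around \<open>1\<close> for \<open>j > s\<close>, odd differences larger than \<open>1\<close> around \<open>k + 1/2\<close>; the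
  differences \<open>1\<close> and \<open>2 s\<close> fill the gaps. The representatives lie in a window \<open>[lo, hi]\<close> of
  length \<open>2 k\<close>, so \<open>D\<close>, a left inverse of \<open>Z\<close>, gives injectivity modulo \<open>2 k\<close>.
\<close>
lemma starter_factorizable:
  fixes s e :: int
  assumes s: "s \<ge> 1" and e: "e = 0 \<or> e = 1"
  shows "factorizable (insert None (Some ` {0..<2 * (4 * s + e)}))"
proof -
  define k where "k = 4 * s + e"
  define hi where "hi = 6 * s + e + 1"
  define lo where "lo = hi - 2 * k + 1"
  define half where "half d = (if d = 0 then k else if d = k then 0 else if d = 1 then s
     else if d = 2 * s then k + 1 else if odd d then k - d div 2
     else if d < 2 * s then - (d div 2) else 1 - d div 2)" for d
  \<comment> \<open>Differences above \<open>k\<close> belong to reversed arcs, so their tails are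
    the upper ends \<open>half c + c\<close> with \<open>c = 2 * k - d\<close>.\<close>
  define Z where "Z d = (if d \<le> k then half d else half (2 * k - d) + (2 * k - d))" for d
  \<comment> \<open>Six isolated values come first. The remaining ranges ascend: ends
    \<open>1 - j\<close>, \<open>- j\<close>, \<open>j\<close>, \<open>1 + j\<close> of even
    differences \<open>2 * j\<close>, then lower and upper ends of odd ones. The even and odd blocks
    meet at \<open>k - 2 * s\<close> because \<open>k\<close> is \<open>4 * s\<close> or
    \<open>4 * s + 1\<close>.\<close>
  define D where "D z = (if z = 0 then k else if z = k then 0
     else if z = s then 1 else if z = s + 1 then 2 * k - 1
     else if z = k + 1 then 2 * s else if z = k + 2 * s + 1 then 2 * k - 2 * s
     else if z < 1 - s then 2 - 2 * z else if z < 0 then - 2 * z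
     else if z < s then 2 * k - 2 * z else if z \<le> k - 2 * s then 2 * k + 2 - 2 * z
     else if z < k then 2 * (k - z) + 1 else 2 * k - 1 - 2 * (z - k - 1))" for z
  have bounds: "s \<ge> 1" "4 * s \<le> k" "k \<le> 4 * s + 1"
    using s e by (auto simp: k_def)
  have hi_eq: "hi = k + 2 * s + 1" by (simp add: hi_def k_def)
  have ZD_even: "lo \<le> Z d \<and> Z d \<le> hi \<and> D (Z d) = d" if d: "0 \<le> d" "d < 2 * k" "d = 2 * j" for d j
  proof -
    \<comment> \<open>The last three cases reverse the arcs of the three before them, in the same
      order.\<close>
    consider "j = 0"
      | "2 * j = k"
      | "j = s"
      | "0 < j" "j < s"
      | "s < j" "2 * j < k"
      | "j = k - s"
      | "k - s < j" "j < k"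
      | "k < 2 * j" "j < k - s"
      using d bounds by linarith
    then show ?thesis
    proof cases
      case 1
      then have "Z d = k" using d bounds by (auto simp: Z_def half_def)
      then show ?thesis using 1 d bounds by (auto simp: D_def lo_def hi_eq)
    next
      case 2
      then have "Z d = 0" using d bounds by (auto simp: Z_def half_def)
      then show ?thesis using 2 d bounds by (auto simp: D_def lo_def hi_eq)
    next
      case 3
      then have "Z d = k + 1" using d bounds by (auto simp: Z_def half_def)
      then show ?thesis using 3 d bounds by (auto simp: D_def lo_def hi_eq)
    next
      case 4
      then have "Z d = - j" using d bounds by (auto simp: Z_def half_def)
      then show ?thesis using 4 d bounds by (auto simp: D_def lo_def hi_eq)
    next
      case 5
      then have "Z d = 1 - j" using d bounds by (auto simp: Z_def half_def)
      then show ?thesis using 5 d bounds by (auto simp: D_def lo_def hi_eq)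
    next
      case 6
      then have "Z d = k + 1 + 2 * s" using d bounds by (auto simp: Z_def half_def)
      then show ?thesis using 6 d bounds by (auto simp: D_def lo_def hi_eq)
    next
      case 7
      then have "Z d = k - j" using d bounds by (auto simp: Z_def half_def)
      then show ?thesis using 7 d bounds by (auto simp: D_def lo_def hi_eq)
    next
      case 8
      then have "Z d = k - j + 1" using d bounds by (auto simp: Z_def half_def)
      then show ?thesis using 8 d bounds by (auto simp: D_def lo_def hi_eq)
    qed
  qed
  have ZD_odd: "lo \<le> Z d \<and> Z d \<le> hi \<and> D (Z d) = d" if d: "0 \<le> d" "d < 2 * k" "d = 2 * j + 1" for d j
  proof -
    have ne: "d \<noteq> 2 * s" "2 * k - d \<noteq> 2 * s" using d(3) by presburger+
    consider "2 * j + 1 = k"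
      | "j = 0"
      | "0 < j" "2 * j + 1 < k"
      | "j = k - 1"
      | "k < 2 * j + 1" "j < k - 1"
      using d bounds by linarith
    then show ?thesis
    proof cases
      case 1
      then have "Z d = 0" using d ne bounds by (auto simp: Z_def half_def)
      then show ?thesis using 1 d bounds by (auto simp: D_def lo_def hi_eq)
    next
      case 2
      then have "Z d = s" using d ne bounds by (auto simp: Z_def half_def)
      then show ?thesis using 2 d bounds by (auto simp: D_def lo_def hi_eq)
    next
      case 3
      then have "Z d = k - j" using d ne bounds by (auto simp: Z_def half_def)
      then show ?thesis using 3 d bounds by (auto simp: D_def lo_def hi_eq)
    next
      case 4
      then have "Z d = s + 1" using d ne bounds by (auto simp: Z_def half_def)
      then show ?thesis using 4 d bounds by (auto simp: D_def lo_def hi_eq)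
    next
      case 5
      then have "Z d = 2 * k - j" using d ne bounds by (auto simp: Z_def half_def)
      then show ?thesis using 5 d bounds by (auto simp: D_def lo_def hi_eq)
    qed
  qed
  have ZD: "lo \<le> Z d \<and> Z d \<le> hi \<and> D (Z d) = d" if "d \<in> {0..<2 * k}" for d
    using that ZD_even ZD_odd by (cases "even d") (auto elim!: evenE oddE)
  have "k \<ge> 4" using s e by (auto simp: k_def)
  show ?thesis
    unfolding k_def[symmetric]
  proof (rule cyclic_factorizable[of k "\<lambda>d. Z d mod (2 * k)"])
    show "inj_on (\<lambda>d. Z d mod (2 * k)) {0..<2 * k}"
    proof (rule inj_onI)
      fix c d assume cd: "c \<in> {0..<2 * k}" "d \<in> {0..<2 * k}" "Z c mod (2 * k) = Z d mod (2 * k)"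
      \<comment> \<open>Shifting by \<open>lo\<close> moves the window to
        \<open>{0..<2 * k}\<close>, where congruence is equality.\<close>
      then have "(Z c - lo) mod (2 * k) = (Z d - lo) mod (2 * k)" by (intro mod_diff_cong) auto
      moreover have "Z c - lo \<in> {0..<2 * k}" "Z d - lo \<in> {0..<2 * k}"
        using ZD[OF cd(1)] ZD[OF cd(2)] by (auto simp: lo_def)
      ultimately have "Z c = Z d" by auto
      then show "c = d" using ZD cd by metis
    qed
    show "Z 0 mod (2 * k) = k" "Z k mod (2 * k) = 0"
      using \<open>k \<ge> 4\<close> by (auto simp: Z_def half_def)
    show "Z (2 * k - d) mod (2 * k) = (Z d mod (2 * k) + d) mod (2 * k)"
      if "d \<in> {0<..<2 * k} - {k}" for d
    proof (cases "d < k")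
      case True
      then show ?thesis by (simp add: Z_def mod_simps)
    next
      case False
      then have "Z d + d = Z (2 * k - d) + 2 * k" using that by (simp add: Z_def)
      then show ?thesis by (simp add: mod_simps)
    qed
  qed (use \<open>k \<ge> 4\<close> in auto)
qed

text \<open>Three vertices lie below the range \<open>s \<ge> 1\<close> of the starter; the factors
  are the two orientations of one triangle. Doubling from here leads to orders 7, 15, 31 and so
  on.\<close>

lemma triangle_factorizable: "factorizable (insert None (Some ` {0..<2::int}))"
proof -
  have "factorizable (insert None (Some ` {0..<2 * (1::int)}))"
    by (rule cyclic_factorizable[of 1 "\<lambda>d. if d = 0 then 1 else 0"]) (auto simp: inj_on_def)
  then show ?thesis by simp
qed

lemma factorizable_1_3_mod_8:
  fixes V :: "'a set"
  assumes fin: "finite V" and n: "card V \<ge> 3" "card V mod 8 = 1 \<or> card V mod 8 = 3"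
  shows "factorizable V"
proof (cases "card V = 3")
  case True
  have "card (insert None (Some ` {0..<2::int})) = 3" by (simp add: card_image)
  then show ?thesis
    using factorizable_card[OF triangle_factorizable _ fin] True by simp
next
  case False
  define s where "s = int (card V div 8)"
  define e where "e = (if card V mod 8 = 1 then 0 else 1 :: int)"
  have "int (card V) = 2 * (4 * s + e) + 1" using n unfolding s_def e_def by auto presburger+
  moreover have "s \<ge> 1" using False n unfolding s_def by presburger
  moreover have "card (insert None (Some ` {0..<2 * (4 * s + e)})) = nat (2 * (4 * s + e)) + 1"
    by (simp add: card_image)
  moreover have "e = 0 \<or> e = 1" by (simp add: e_def)
  ultimately show ?thesis
    by (intro factorizable_card[OF starter_factorizable[of s e] _ fin]) auto
qed

section \<open>Doubling\<close>

lemma mod_diff_eq_iff: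
  fixes x y z N :: int
  assumes "x \<in> {0..<N}" "z \<in> {0..<N}"
  shows "(x - y) mod N = z \<longleftrightarrow> x = (y + z) mod N"
proof
  assume "(x - y) mod N = z"
  then have "(y + z) mod N = (y + (x - y) mod N) mod N" by simp
  then show "x = (y + z) mod N" using assms(1) by (simp add: mod_simps)
next
  assume "x = (y + z) mod N"
  then show "(x - y) mod N = z" using assms(2) by (simp add: mod_simps)
qed

text \<open>
  The standard one-factorization of the complete graph on \<open>{0..m}\<close>, \<open>m = 2 k - 1\<close>: vertex \<open>m\<close>
  plays the role of infinity, and \<open>x, y < m\<close> are joined in factor \<open>j\<close> if \<open>x + y\<close> is congruent to
  \<open>j\<close>. Note that \<open>k\<close> is the inverse of \<open>2\<close> modulo \<open>m\<close>.
\<close>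
definition near_one_factor :: "int \<Rightarrow> int \<Rightarrow> int \<Rightarrow> int" where
  "near_one_factor k j x = (let m = 2 * k - 1 in
     if x = m then (k * j) mod m else if (2 * x) mod m = j then m else (j - x) mod m)"

lemma half_mod_iff:
  fixes k x j :: int
  assumes "m = 2 * k - 1" "x \<in> {0..<m}" "j \<in> {0..<m}"
  shows "(k * j) mod m = x \<longleftrightarrow> (2 * x) mod m = j"
proof
  assume "(k * j) mod m = x"
  then have "(2 * x) mod m = (2 * (k * j)) mod m" by (auto simp: mod_simps)
  also have "2 * (k * j) = j + m * j" by (simp add: assms(1) algebra_simps)
  finally show "(2 * x) mod m = j" using assms(3) by simp
next
  assume "(2 * x) mod m = j"
  then have "(k * j) mod m = (k * (2 * x)) mod m" by (auto simp: mod_simps)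
  also have "k * (2 * x) = x + m * x" by (simp add: assms(1) algebra_simps)
  finally show "(k * j) mod m = x" using assms(2) by simp
qed

context
  fixes k m :: int
  assumes k: "k \<ge> 2" and m: "m = 2 * k - 1"
begin

text \<open>Below \<open>m\<close>, being partners means having sum \<open>j\<close> modulo
  \<open>m\<close>, a symmetric condition. As \<open>m\<close> is odd, exactly one vertex would be
  its own partner, and it is paired with \<open>m\<close> instead.\<close>

lemma near_one_factor_perm:
  assumes j: "j \<in> {0..<m}" and x: "x \<in> {0..m}"
  shows "near_one_factor k j x \<in> {0..m} \<and> near_one_factor k j x \<noteq> x \<and>
    near_one_factor k j (near_one_factor k j x) = x"
proof -
  have m0: "m > 0" using k m by simp
  have mm: "z mod m \<in> {0..<m}" for z using m0 by simp
  note half = half_mod_iff[OF m _ j]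
  note nof = near_one_factor_def[of k j, unfolded Let_def, folded m]
  consider "x = m" | "x \<noteq> m" "(2 * x) mod m = j" | "x \<noteq> m" "(2 * x) mod m \<noteq> j" by blast
  then show ?thesis
  proof cases
    case 1
    then have "near_one_factor k j x = (k * j) mod m" by (simp add: nof)
    moreover have "(2 * ((k * j) mod m)) mod m = j" using half mm by blast
    ultimately show ?thesis using 1 mm[of "k * j"] by (auto simp: nof)
  next
    case 2
    then have "(k * j) mod m = x" using half x by auto
    with 2 m0 show ?thesis by (auto simp: nof)
  next
    case 3
    define y where "y = (j - x) mod m"
    have xm: "x \<in> {0..<m}" using 3 x by auto
    have y: "y \<in> {0..<m}" unfolding y_def by (rule mm)
    have jxy: "j = (x + y) mod m" by (rule mod_diff_eq_iff[OF j y, THEN iffD1]) (simp add: y_def)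
    then have "y \<noteq> x" using 3 by auto
    moreover have "(2 * y) mod m \<noteq> j"
    proof
      assume "(2 * y) mod m = j"
      then have "(y + x) mod m = (y + y) mod m" using jxy by (simp add: add.commute)
      then have "(y + x - y) mod m = (y + y - y) mod m" by (intro mod_diff_cong) auto
      then show False using xm y \<open>y \<noteq> x\<close> by simp
    qed
    moreover have "(j - y) mod m = x" using mod_diff_eq_iff[OF j xm] jxy by (simp add: add.commute)
    ultimately show ?thesis using 3 y by (auto simp: nof simp flip: y_def)
  qed
qed

text \<open>The pair determines the index modulo \<open>m\<close>: it is the sum, or twice the other
  vertex when one of the two is \<open>m\<close>.\<close>

lemma near_one_factor_unique:
  assumes x: "x \<in> {0..m}" and y: "y \<in> {0..m}" and "x \<noteq> y"
  shows "\<exists>!j. j \<in> {0..<m} \<and> near_one_factor k j x = y"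
proof -
  have m0: "m > 0" using k m by simp
  have mm: "z mod m \<in> {0..<m}" for z using m0 by simp
  note nof = near_one_factor_def[of k, unfolded Let_def, folded m]
  define i where "i = (if x = m then 2 * y mod m else if y = m then 2 * x mod m else (x + y) mod m)"
  have i: "i \<in> {0..<m}" unfolding i_def using mm by auto
  have "near_one_factor k j x = y \<longleftrightarrow> j = i" if j: "j \<in> {0..<m}" for j
  proof -
    consider "x = m" | "x \<noteq> m" "y = m" | "x \<noteq> m" "y \<noteq> m" by blast
    then show ?thesis
    proof cases
      case 1
      then show ?thesis using half_mod_iff[OF m, of y j] assms j by (auto simp: nof i_def)
    next
      case 2
      then show ?thesis using mm[of "j - x"] by (auto simp: nof i_def)
    next
      case 3
      then have "x \<in> {0..<m}" "y \<in> {0..<m}" using x y by auto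
      note xy = mod_diff_eq_iff[OF j this(2), of x]
      show ?thesis
      proof (cases "(2 * x) mod m = j")
        case True
        have "j \<noteq> (x + y) mod m"
        proof
          assume "j = (x + y) mod m"
          then have "(x + y - x) mod m = (2 * x - x) mod m"
            using True by (intro mod_diff_cong) auto
          then show False using \<open>x \<noteq> y\<close> \<open>x \<in> {0..<m}\<close> \<open>y \<in> {0..<m}\<close> by simp
        qed
        then show ?thesis using 3 True by (auto simp: nof i_def)
      next
        case False
        then show ?thesis using 3 xy by (simp add: nof i_def)
      qed
    qed
  qed
  then show ?thesis using i by blast
qed

text \<open>This one-factor is the one reserved for the triangles in the doubling. The closed form
  treats the pair \<open>0\<close>, \<open>m\<close> like all others.\<close>

lemma near_one_factor_0:
  assumes "x \<in> {0..m}"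
  shows "near_one_factor k 0 x = m - x"
proof (cases "x = 0 \<or> x = m")
  case True
  then show ?thesis using k m by (auto simp: near_one_factor_def Let_def)
next
  case False
  with assms have x: "0 < x" "x < m" by auto
  have "(2 * x) mod m \<noteq> 0"
  proof
    assume "(2 * x) mod m = 0"
    then have "x = 0" using half_mod_iff[OF m, of x 0] x by auto
    then show False using x by simp
  qed
  moreover have "(- x) mod m = m - x"
    using x by (simp add: zmod_zminus1_eq_if)
  ultimately show ?thesis using x m by (simp add: near_one_factor_def Let_def)
qed

end

text \<open>With \<open>m = 2 * k - 1\<close>, the left summand contributes \<open>m - 1\<close>
  factors and each of the \<open>m + 1\<close> points on the right contributes one:
  \<open>2 * m\<close> in all, the out-degree of a vertex.\<close>

lemma double_factorizable:
  fixes k :: int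
  assumes k: "k \<ge> 2" and A: "factorizable {1..<2 * k}"
  shows "factorizable ({1..<2 * k} <+> {0..<2 * k})"
proof -
  define N where "N = 2 * k"
  define m where "m = 2 * k - 1"
  have N: "N > 0" "{0..<N} = {0..m}" using k by (auto simp: N_def m_def)
  have mm: "z mod N \<in> {0..<N}" for z using N(1) by simp
  obtain P where P: "\<forall>p\<in>P. factor_perm {1..<N} p"
    and ex1: "\<forall>u\<in>{1..<N}. \<forall>v\<in>{1..<N}. u \<noteq> v \<longrightarrow> (\<exists>!p. p \<in> P \<and> p u = v)"
    using A unfolding N_def by (rule factorizableE)
  \<comment> \<open>Each vertex other than 1 is the image of 1 under exactly one factor, so the
    \<open>m - 1\<close> factors can share the indices \<open>{1..<m}\<close> with the one-factors
    other than number 0.\<close>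
  have "bij_betw (\<lambda>p. p 1) P {2..<N}"
  proof (rule bij_betwI')
    have one: "1 \<in> {1..<N}" using k by (simp add: N_def)
    have im: "p 1 \<in> {1..<N}" "p 1 \<noteq> 1" if "p \<in> P" for p
      using factor_perm_dest[OF _ one] P that by auto
    show "p 1 \<in> {2..<N}" if "p \<in> P" for p using im[OF that] by auto
    show "p 1 = q 1 \<longleftrightarrow> p = q" if "p \<in> P" "q \<in> P" for p q
      using ex1[rule_format, OF one im(1)[OF that(1)]] im(2)[OF that(1)] that by metis
    show "\<exists>p\<in>P. v = p 1" if "v \<in> {2..<N}" for v
      using ex1[rule_format, OF one, of v] that by auto
  qed
  moreover have "bij_betw (\<lambda>j. j + 1) {1..<m} {2..<N}"
    by (rule bij_betw_byWitness[where f' = "\<lambda>j. j - 1"]) (auto simp: N_def m_def)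
  ultimately obtain h where h: "bij_betw h {1..<m} P"
    by (meson bij_betw_inv_into bij_betw_trans)
  note nof = near_one_factor_perm[OF k m_def, folded N(2)]
    and nof_unique = near_one_factor_unique[OF k m_def, folded N(2)]
    and nof_0 = near_one_factor_0[OF k m_def, folded N(2)]
  define \<rho> where "\<rho> = near_one_factor k"
  define f where "f b = (if b < k then b else 3 * k - 1 - b)" for b
  have f: "f b \<in> {0..<N}" "f (f b) = b" if "b \<in> {0..<N}" for b
    using that by (auto simp: f_def N_def)
  have f_eq: "f b = c \<longleftrightarrow> b = f c" if "b \<in> {0..<N}" "c \<in> {0..<N}" for b c
    using f that by metis
  have f_opp: "f (m - b) = (f b + k) mod N" if "b \<in> {0..<N}" for b
  proof (cases "b < k")
    case True
    then show ?thesis using that by (auto simp: f_def N_def m_def)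
  next
    case False
    then have "f b + k = f (m - b) + N" by (simp add: f_def N_def m_def)
    moreover have "f (m - b) \<in> {0..<N}" using that by (intro f) (auto simp: N_def m_def)
    ultimately show ?thesis by simp
  qed
  \<comment> \<open>Relabelling by \<open>f\<close> turns the one-factor \<open>b \<leftrightarrow> m - b\<close> into \<open>x \<leftrightarrow> x + k\<close>. Hence deleting the
    columns \<open>0\<close> and \<open>k\<close> from the addition table modulo \<open>N\<close> leaves, for each symbol, a matching
    that misses exactly one triangle \<open>k, t, m - t\<close>.\<close>
  define q where "q i v = (case i of
      Inl j \<Rightarrow> (case v of Inl a \<Rightarrow> Inl (h j a) | Inr b \<Rightarrow> Inr (\<rho> j b))
    | Inr t \<Rightarrow> (case v of
          Inl a \<Rightarrow> if a = k then Inr t else Inr (f ((f t - a) mod N))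
        | Inr b \<Rightarrow> if b = t then Inr (m - t) else Inl ((f t - f b) mod N)))" for i v
  let ?V = "{1..<N} <+> {0..<N}" and ?I = "{1..<m} <+> {0..<N}"
  have "factorizable ?V"
  proof (rule factorizableI[of ?I _ q])
    fix i assume "i \<in> ?I"
    then show "factor_perm ?V (q i)"
    proof (elim PlusE)
      fix j assume j: "i = Inl j" "j \<in> {1..<m}"
      then have "factor_perm {1..<N} (h j)" using P h by (auto simp: bij_betw_def)
      then obtain a b c where abc: "{a, b, c} \<subseteq> {1..<N}" "distinct [a, b, c]"
        "h j a = b" "h j b = c" "h j c = a"
        and inv: "\<forall>v\<in>{1..<N} - {a, b, c}. h j v \<in> {1..<N} - {a, b, c} \<and> h j v \<noteq> v \<and> h j (h j v) = v"
        by (rule factor_permE)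
      show ?thesis
      proof (rule factor_permI[of "Inl a" "Inl b" "Inl c"])
        fix v assume v: "v \<in> ?V - {Inl a, Inl b, Inl c}"
        show "q i v \<in> ?V - {Inl a, Inl b, Inl c} \<and> q i v \<noteq> v \<and> q i (q i v) = v"
        proof (cases v)
          case (Inl x)
          then have "x \<in> {1..<N} - {a, b, c}" using v by auto
          with inv have "h j x \<in> {1..<N} - {a, b, c}" "h j x \<noteq> x" "h j (h j x) = x" by blast+
          then show ?thesis by (auto simp: q_def j(1) Inl)
        next
          case (Inr x)
          then have "x \<in> {0..<N}" using v by auto
          with nof[of j x] j have "\<rho> j x \<in> {0..<N}" "\<rho> j x \<noteq> x" "\<rho> j (\<rho> j x) = x"
            by (auto simp: \<rho>_def)
          then show ?thesis by (auto simp: q_def j(1) Inr)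
        qed
      qed (use abc in \<open>auto simp: q_def j(1)\<close>)
    next
      fix t assume t: "i = Inr t" "t \<in> {0..<N}"
      \<comment> \<open>\<open>m\<close> is odd, so no point is its own opposite.\<close>
      have t': "m - t \<in> {0..<N}" "m - t \<noteq> t" using t by (auto simp: m_def N_def) presburger
      have ft: "f t \<in> {0..<N}" using t f by auto
      have kN: "k \<in> {1..<N}" using k by (auto simp: N_def)
      have f_opp_t: "(f t - f (m - t)) mod N = k"
        using mod_diff_eq_iff[of "f t" N k "f (m - t)"] f_opp[OF t'(1)] ft kN by simp
      have fb: "(f t - f b) mod N = a \<longleftrightarrow> f ((f t - a) mod N) = b"
        if "a \<in> {0..<N}" "b \<in> {0..<N}" for a b
        using mod_diff_eq_iff[OF ft that(1), of "f b"] mod_diff_eq_iff[OF ft f(1)[OF that(2)], of a]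
          f_eq[OF mm that(2)] by (simp add: add.commute)
      \<comment> \<open>For the deleted columns \<open>0\<close> and \<open>k\<close> the rule would
        return the triangle vertices \<open>t\<close> and \<open>m - t\<close>.\<close>
      have eq_t: "f ((f t - a) mod N) = t \<longleftrightarrow> a = 0" if "a \<in> {0..<N}" for a
        using fb[OF that t(2)] by auto
      have eq_opp: "f ((f t - a) mod N) = m - t \<longleftrightarrow> a = k" if "a \<in> {0..<N}" for a
        using fb[OF that t'(1)] f_opp_t by auto
      show ?thesis
      proof (rule factor_permI[of "Inl k" "Inr t" "Inr (m - t)"])
        show "q i (Inr (m - t)) = Inl k"
          using f_opp_t t'(2) by (simp add: q_def t(1))
        fix v assume v: "v \<in> ?V - {Inl k, Inr t, Inr (m - t)}"
        show "q i v \<in> ?V - {Inl k, Inr t, Inr (m - t)} \<and> q i v \<noteq> v \<and> q i (q i v) = v"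
        proof (cases v)
          case (Inl a)
          then have a: "a \<in> {1..<N}" "a \<noteq> k" "a \<in> {0..<N}" "a \<noteq> 0" using v by auto
          define b where "b = f ((f t - a) mod N)"
          have b: "b \<in> {0..<N}" unfolding b_def by (intro f mm)
          have "(f t - f b) mod N = a" using fb[OF a(3) b] b_def by simp
          moreover have "b \<noteq> t" "b \<noteq> m - t" using eq_t eq_opp a unfolding b_def by auto
          ultimately show ?thesis using a b by (auto simp: q_def t(1) Inl b_def[symmetric])
        next
          case (Inr b)
          then have b: "b \<in> {0..<N}" "b \<noteq> t" "b \<noteq> m - t" using v by auto
          define a where "a = (f t - f b) mod N"
          have a: "a \<in> {0..<N}" unfolding a_def by (rule mm)
          have ba: "b = f ((f t - a) mod N)" using fb[OF a b(1)] a_def by simp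
          with b eq_t eq_opp a have "a \<noteq> 0" "a \<noteq> k" by auto
          moreover from this have "q i v = Inl a" "q i (Inl a) = Inr b"
            using b(2) by (simp_all add: q_def t(1) Inr flip: a_def ba)
          ultimately show ?thesis using a b by (auto simp: Inr)
        qed
      qed (use t t' kN in \<open>auto simp: q_def\<close>)
    qed
  next
    fix u v assume uv: "u \<in> ?V" "v \<in> ?V" "u \<noteq> v"
    show "\<exists>!i. i \<in> ?I \<and> q i u = v"
    proof (cases u; cases v)
      fix a c assume uv': "u = Inl a" "v = Inl c"
      then have "a \<in> {1..<N}" "c \<in> {1..<N}" "a \<noteq> c" using uv by auto
      from ex1[rule_format, OF this] obtain p where p: "p \<in> P \<and> p a = c" "\<forall>p'. p' \<in> P \<and> p' a = c \<longrightarrow> p' = p"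
        by (rule ex1E)
      then obtain j where j: "j \<in> {1..<m}" "h j = p"
        using h unfolding bij_betw_def by blast
      show ?thesis
      proof (rule ex1I[of _ "Inl j"])
        fix i assume i: "i \<in> ?I \<and> q i u = v"
        then obtain j' where j': "i = Inl j'" "j' \<in> {1..<m}" "h j' a = c"
          by (auto simp: q_def uv' split: if_splits)
        then have "h j' = h j" using p(2) j(2) h by (auto simp: bij_betw_apply)
        then show "i = Inl j" using j' j(1) h by (metis bij_betw_imp_inj_on inj_onD)
      qed (use p(1) j in \<open>simp add: q_def uv' InlI\<close>)
    next
      fix a b assume uv': "u = Inl a" "v = Inr b"
      then have a: "a \<in> {0..<N}" and b: "b \<in> {0..<N}" using uv by auto
      \<comment> \<open>The arc from \<open>k\<close> to \<open>b\<close> opens the triangle with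
        \<open>t = b\<close>; any other \<open>a\<close> forms a 2-cycle with
        \<open>b\<close>.\<close>
      define t where "t = (if a = k then b else f ((f b + a) mod N))"
      have t: "t \<in> {0..<N}" using b f(1)[OF mm] by (auto simp: t_def)
      have "q (Inr t') u = v \<longleftrightarrow> t' = t" if t': "t' \<in> {0..<N}" for t'
        using mod_diff_eq_iff[OF f(1)[OF t'] f(1)[OF b], of a] f_eq[OF mm b] f_eq[OF t' mm]
        by (simp add: q_def uv' t_def add.commute)
      then show ?thesis using t by (intro ex1I[of _ "Inr t"]) (auto simp: q_def uv')
    next
      fix b a assume uv': "u = Inr b" "v = Inl a"
      then have a: "a \<in> {0..<N}" "a \<noteq> 0" and b: "b \<in> {0..<N}" using uv by auto
      \<comment> \<open>For \<open>a = k\<close> this gives \<open>t = m - b\<close>, whose triangle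
        contains the arc from \<open>b\<close> to \<open>k\<close>, so no case distinction
        arises.\<close>
      define t where "t = f ((f b + a) mod N)"
      have t: "t \<in> {0..<N}" using f(1)[OF mm] by (auto simp: t_def)
      have "q (Inr t') u = v \<longleftrightarrow> t' = t" if t': "t' \<in> {0..<N}" for t'
        using mod_diff_eq_iff[OF f(1)[OF t'] a(1), of "f b"] f_eq[OF t' mm] a(2)
        by (auto simp: q_def uv' t_def)
      then show ?thesis using t by (intro ex1I[of _ "Inr t"]) (auto simp: q_def uv')
    next
      fix b c assume uv': "u = Inr b" "v = Inr c"
      then have bc: "b \<in> {0..<N}" "c \<in> {0..<N}" "b \<noteq> c" using uv by auto
      \<comment> \<open>An edge of a one-factor \<open>j > 0\<close> is a 2-cycle alongside
        \<open>h j\<close>. In one-factor 0 the arc from \<open>b\<close> to \<open>m - b\<close> is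
        a side of the triangle indexed by \<open>b\<close>, so its two directions go to different
        factors.\<close>
      obtain j where j: "j \<in> {0..<m}" "\<rho> j b = c"
        and unique: "\<And>j'. j' \<in> {0..<m} \<Longrightarrow> \<rho> j' b = c \<Longrightarrow> j' = j"
        using nof_unique[OF bc] unfolding \<rho>_def by blast
      have \<rho>0: "\<rho> 0 b = m - b" using nof_0[OF bc(1)] by (simp add: \<rho>_def)
      have m0: "0 \<in> {0..<m}" using k by (simp add: m_def)
      have qL: "q (Inl j') u = v \<longleftrightarrow> j' = j" if "j' \<in> {1..<m}" for j'
        using unique[of j'] j(2) that by (auto simp: q_def uv')
      have qR: "q (Inr t) u = v \<longleftrightarrow> t = b \<and> c = m - b" for t
        by (auto simp: q_def uv')
      have j0: "j = 0 \<longleftrightarrow> c = m - b" using unique[OF m0] j(2) \<rho>0 by auto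
      show ?thesis
      proof (cases "j = 0")
        case True
        show ?thesis
        proof (rule ex1I[of _ "Inr b"])
          show "Inr b \<in> ?I \<and> q (Inr b) u = v" using True j0 bc(1) qR by auto
          show "i = Inr b" if "i \<in> ?I \<and> q i u = v" for i
            using that qL[of "projl i"] qR[of "projr i"] True by (cases i) auto
        qed
      next
        case False
        show ?thesis
        proof (rule ex1I[of _ "Inl j"])
          show "Inl j \<in> ?I \<and> q (Inl j) u = v" using False j(1) qL by auto
          show "i = Inl j" if "i \<in> ?I \<and> q i u = v" for i
            using that qL[of "projl i"] qR[of "projr i"] False j0 by (cases i) auto
        qed
      qed
    qed
  qed
  then show ?thesis by (simp add: N_def)
qed

section \<open>Induction on the order\<close>

lemma factorizable_double_card:
  fixes V :: "'a set" and W :: "'b set"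
  assumes V: "factorizable V" "finite V" "odd (card V)" "card V \<ge> 3"
    and W: "finite W" "card W = 2 * card V + 1"
  shows "factorizable W"
proof -
  obtain j where j: "card V = 2 * j + 1" using V(3) by (rule oddE)
  define k where "k = int j + 1"
  have card_V: "int (card V) = 2 * k - 1" "k \<ge> 2" using j V(4) by (auto simp: k_def)
  have "factorizable {1..<2 * k}"
    by (rule factorizable_card[OF V(1,2)]) (use card_V in auto)
  from double_factorizable[OF card_V(2) this] show ?thesis
    by (rule factorizable_card) (use card_V W in \<open>auto simp: card_Plus\<close>)
qed

text \<open>If \<open>n\<close> is 7 modulo 8, then \<open>(n - 1) div 2\<close> is 3 modulo 4,
  hence 3 or 7 modulo 8, so halving never leaves the admissible orders.\<close>

lemma factorizable_mod_8:
  fixes V :: "'a set"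
  assumes "finite V" "card V \<ge> 3" "card V mod 8 = 1 \<or> card V mod 8 = 3 \<or> card V mod 8 = 7"
  shows "factorizable V"
proof -
  have "factorizable {..<n}" if "n \<ge> 3" "n mod 8 = 1 \<or> n mod 8 = 3 \<or> n mod 8 = 7" for n :: nat
    using that
  proof (induction n rule: less_induct)
    case (less n)
    show ?case
    proof (cases "n mod 8 = 7")
      case False
      then show ?thesis using less.prems by (intro factorizable_1_3_mod_8) auto
    next
      case True
      define m where "m = (n - 1) div 2"
      have m: "m < n" "m \<ge> 3" "m mod 8 = 3 \<or> m mod 8 = 7" "odd m" "n = 2 * m + 1"
        using True unfolding m_def by presburger+
      have "factorizable {..<m}" using less.IH m(1,2,3) by blast
      then show ?thesis by (rule factorizable_double_card) (use m in auto)
    qed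
  qed
  from this[OF assms(2,3)] show ?thesis
    by (rule factorizable_card) (use assms(1) in auto)
qed

section \<open>Complete digraphs\<close>

text \<open>\<open>cycle_factor\<close> asks for a list of cycles; \<open>xs\<close> takes one
  vertex from each 2-cycle. The induction removes a pair \<open>x\<close>, \<open>p x\<close>, whose
  complement is still invariant.\<close>

lemma involution_transversal:
  assumes "finite S" and "\<And>v. v \<in> S \<Longrightarrow> p v \<in> S \<and> p v \<noteq> v \<and> p (p v) = v"
  shows "\<exists>xs. distinct (xs @ map p xs) \<and> set (xs @ map p xs) = S"
  using assms
proof (induction S rule: finite_psubset_induct)
  case (psubset S)
  show ?case
  proof (cases "S = {}")
    case False
    then obtain x where x: "x \<in> S" by blast
    note px = psubset.prems[OF x]
    let ?S = "S - {x, p x}"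
    have "p v \<in> ?S \<and> p v \<noteq> v \<and> p (p v) = v" if "v \<in> ?S" for v
      using that psubset.prems[of v] px by auto
    then obtain xs where xs: "distinct (xs @ map p xs)" "set (xs @ map p xs) = ?S"
      using psubset.IH[of ?S] x by blast
    have "x \<notin> set (xs @ map p xs)" "p x \<notin> set (xs @ map p xs)" unfolding xs(2) by auto
    then have "distinct ((x # xs) @ map p (x # xs))" using xs(1) px by auto
    moreover have "set ((x # xs) @ map p (x # xs)) = insert x (insert (p x) (set (xs @ map p xs)))"
      by auto
    then have "set ((x # xs) @ map p (x # xs)) = S" unfolding xs(2) using x px by auto
    ultimately show ?thesis by blast
  qed simp
qed

section \<open>Translation of maps into subdigraphs\<close>

context
  fixes n :: nat and G :: "('a, 'b) pre_digraph"
  assumes G: "complete_digraph n G"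
begin

interpretation graph G using G by (simp add: complete_digraph_def)

definition arc_of :: "'a \<Rightarrow> 'a \<Rightarrow> 'b" where
  "arc_of u v = (SOME e. e \<in> arcs G \<and> tail G e = u \<and> head G e = v)"

text \<open>The parameter \<open>S\<close> lets one construction give both a whole factor and each
  of its cycles.\<close>

definition perm_subgraph :: "('a \<Rightarrow> 'a) \<Rightarrow> 'a set \<Rightarrow> ('a, 'b) pre_digraph" where
  "perm_subgraph p S = \<lparr>verts = S, arcs = (\<lambda>v. arc_of v (p v)) ` S, tail = tail G, head = head G\<rparr>"

lemma perm_subgraph_simps [simp]:
  "verts (perm_subgraph p S) = S" "arcs (perm_subgraph p S) = (\<lambda>v. arc_of v (p v)) ` S"
  "tail (perm_subgraph p S) = tail G" "head (perm_subgraph p S) = head G"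
  by (simp_all add: perm_subgraph_def)

lemma arc_of:
  assumes "u \<in> verts G" "v \<in> verts G" "u \<noteq> v"
  shows "arc_of u v \<in> arcs G" "tail G (arc_of u v) = u" "head G (arc_of u v) = v"
proof -
  have "(u, v) \<in> arcs_ends G" using G assms by (simp add: complete_digraph_def)
  then have "\<exists>e. e \<in> arcs G \<and> tail G e = u \<and> head G e = v"
    by (auto simp: arcs_ends_def arc_to_ends_def)
  from someI_ex[OF this] show "arc_of u v \<in> arcs G" "tail G (arc_of u v) = u" "head G (arc_of u v) = v"
    by (auto simp: arc_of_def)
qed

lemma arc_of_ends:
  assumes "e \<in> arcs G"
  shows "tail G e \<in> verts G" "head G e \<in> verts G" "tail G e \<noteq> head G e"
    "arc_of (tail G e) (head G e) = e"
proof -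
  show *: "tail G e \<in> verts G" "head G e \<in> verts G" "tail G e \<noteq> head G e"
    using assms no_loops by auto
  show "arc_of (tail G e) (head G e) = e"
    using no_multi_arcs[OF arc_of(1)[OF *] assms] arc_of(2,3)[OF *] by (simp add: arc_to_ends_def)
qed

lemma subgraph_perm_subgraph:
  assumes "S \<subseteq> verts G" and "\<And>v. v \<in> S \<Longrightarrow> p v \<in> S \<and> p v \<noteq> v"
  shows "subgraph (perm_subgraph p S) G"
proof -
  have *: "arc_of v (p v) \<in> arcs G" "tail G (arc_of v (p v)) = v" "head G (arc_of v (p v)) = p v"
    if "v \<in> S" for v
  proof -
    have "v \<in> verts G" "p v \<in> verts G" "v \<noteq> p v" using assms(1) assms(2)[OF that] that by auto
    from arc_of[OF this] show "arc_of v (p v) \<in> arcs G" "tail G (arc_of v (p v)) = v"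
      "head G (arc_of v (p v)) = p v" .
  qed
  then have "wf_digraph (perm_subgraph p S)"
    using assms(2) by unfold_locales auto
  then show ?thesis
    using * assms(1) wf_digraph_axioms unfolding subgraph_def compatible_def by auto
qed

lemma directed_2cycle:
  assumes "u \<in> verts G" "v \<in> verts G" "u \<noteq> v" "p u = v" "p v = u"
  shows "directed_cycle 2 (perm_subgraph p {u, v})"
  unfolding directed_cycle_def pre_digraph.cycle_def pre_digraph.awalk_def
  using assms arc_of[of u v] arc_of[of v u]
  by (intro exI[of _ "[arc_of u v, arc_of v u]"])
    (auto simp: pre_digraph.cas.simps pre_digraph.awalk_verts.simps)

lemma directed_3cycle:
  assumes "{u, v, w} \<subseteq> verts G" "distinct [u, v, w]" "p u = v" "p v = w" "p w = u"
  shows "directed_cycle 3 (perm_subgraph p {u, v, w})"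
  unfolding directed_cycle_def pre_digraph.cycle_def pre_digraph.awalk_def
  using assms arc_of[of u v] arc_of[of v w] arc_of[of w u]
  by (intro exI[of _ "[arc_of u v, arc_of v w, arc_of w u]"])
    (auto simp: pre_digraph.cas.simps pre_digraph.awalk_verts.simps)

lemma cycle_factor_perm_subgraph:
  assumes p: "factor_perm (verts G) p"
  shows "cycle_factor (replicate ((n - 3) div 2) 2 @ [3]) (perm_subgraph p (verts G)) G"
proof -
  obtain a b c where abc: "{a, b, c} \<subseteq> verts G" "distinct [a, b, c]" "p a = b" "p b = c" "p c = a"
    and inv: "\<forall>v\<in>verts G - {a, b, c}. p v \<in> verts G - {a, b, c} \<and> p v \<noteq> v \<and> p (p v) = v"
    by (rule factor_permE[OF p])
  let ?S = "verts G - {a, b, c}"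
  obtain xs where dist: "distinct (xs @ map p xs)" and set_xs: "set (xs @ map p xs) = ?S"
    using involution_transversal[of ?S p] inv by auto
  have "2 * length xs = card ?S" using distinct_card[OF dist] set_xs by simp
  also have "\<dots> = n - 3"
    using G abc(1,2) card_Diff_subset[of "{a, b, c}" "verts G"] by (simp add: complete_digraph_def)
  finally have len: "length xs = (n - 3) div 2" by simp
  have xs: "x \<in> ?S" "p x \<in> ?S" "p (p x) = x" "p x \<noteq> x" if "x \<in> set xs" for x
    using that set_xs inv by auto
  \<comment> \<open>The triangle comes last, matching the order of the list of lengths.\<close>
  define Ss where "Ss = map (\<lambda>x. {x, p x}) xs @ [{a, b, c}]"
  define Cs where "Cs = map (perm_subgraph p) Ss"
  have two: "directed_cycle 2 (perm_subgraph p {x, p x})" if "x \<in> set xs" for x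
    using xs[OF that] by (intro directed_2cycle) auto
  have cycles: "list_all2 directed_cycle (replicate ((n - 3) div 2) 2 @ [3]) Cs"
    unfolding Cs_def Ss_def map_append
    using two directed_3cycle[OF abc] len
    by (intro list_all2_appendI) (auto simp: list_all2_conv_all_nth)
  have sub: "subgraph C G" if "C \<in> set Cs" for C
  proof -
    from that obtain T where T: "C = perm_subgraph p T" "T \<in> set Ss" by (auto simp: Cs_def)
    have "T \<subseteq> verts G \<and> (\<forall>v\<in>T. p v \<in> T \<and> p v \<noteq> v)"
      using T(2) xs xs(4)[symmetric] abc by (auto simp: Ss_def)
    then show ?thesis unfolding T(1) by (intro subgraph_perm_subgraph) auto
  qed
  have disj_less: "Ss ! i \<inter> Ss ! j = {}" if "i < j" "j < length Ss" for i j
  proof (cases "j = length xs")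
    case True
    then show ?thesis using that xs(1,2)[of "xs ! i"] by (auto simp: Ss_def nth_append)
  next
    case False
    then have ij: "i < length xs" "j < length xs" using that by (auto simp: Ss_def)
    then have "xs ! i \<noteq> xs ! j" "p (xs ! i) \<noteq> p (xs ! j)"
      using dist that(1) by (auto simp: nth_eq_iff_index_eq, metis length_map nat_neq_iff nth_eq_iff_index_eq nth_map)
    moreover have "xs ! i \<noteq> p (xs ! j)" "p (xs ! i) \<noteq> xs ! j"
      using dist ij by (auto simp: disjoint_iff) (metis nth_mem image_eqI)+
    ultimately show ?thesis using ij by (auto simp: Ss_def nth_append)
  qed
  have disj: "verts (Cs ! i) \<inter> verts (Cs ! j) = {}"
    if "i < length Cs" "j < length Cs" "i \<noteq> j" for i j
    using disj_less[of i j] disj_less[of j i] that by (cases "i < j") (auto simp: Cs_def)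
  have union: "\<Union> (set Ss) = verts G"
  proof -
    have "\<Union> (set Ss) = set (xs @ map p xs) \<union> {a, b, c}" by (auto simp: Ss_def)
    also have "\<dots> = verts G" unfolding set_xs using abc(1) by auto
    finally show ?thesis .
  qed
  have "perm_subgraph p (verts G) = Union (set Cs)"
    unfolding Union_def perm_subgraph_def union[symmetric] by (auto simp: Cs_def)
  moreover have "spanning (perm_subgraph p (verts G)) G"
    unfolding spanning_def using factor_perm_dest[OF p] subgraph_perm_subgraph[of "verts G" p] by auto
  ultimately show ?thesis unfolding cycle_factor_def using cycles sub disj by blast
qed

text \<open>An arc \<open>e\<close> lies in the factor of \<open>p\<close> exactly when
  \<open>p (tail G e) = head G e\<close>. Existence of such a \<open>p\<close> gives covering, and
  uniqueness gives disjointness.\<close>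

lemma cycle_factorization_complete:
  assumes V: "factorizable (verts G)"
  shows "\<exists>\<F>. cycle_factorization (replicate ((n - 3) div 2) 2 @ [3]) \<F> G"
proof -
  obtain P where P: "\<forall>p\<in>P. factor_perm (verts G) p"
    and ex1: "\<forall>u\<in>verts G. \<forall>v\<in>verts G. u \<noteq> v \<longrightarrow> (\<exists>!p. p \<in> P \<and> p u = v)"
    by (rule factorizableE[OF V])
  have mem: "e \<in> (\<lambda>v. arc_of v (p v)) ` verts G \<longleftrightarrow> e \<in> arcs G \<and> p (tail G e) = head G e"
    if "p \<in> P" for p e
  proof
    assume "e \<in> (\<lambda>v. arc_of v (p v)) ` verts G"
    then obtain v where v: "v \<in> verts G" "e = arc_of v (p v)" by blast
    have "p v \<in> verts G" "v \<noteq> p v"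
      using factor_perm_dest[OF P[rule_format, OF that] v(1)] by auto
    then show "e \<in> arcs G \<and> p (tail G e) = head G e"
      using arc_of[OF v(1)] v(2) by simp
  next
    assume "e \<in> arcs G \<and> p (tail G e) = head G e"
    then show "e \<in> (\<lambda>v. arc_of v (p v)) ` verts G"
      using arc_of_ends[of e] by (intro image_eqI[of _ _ "tail G e"]) auto
  qed
  have "partition_on (arcs G) (arcs ` (\<lambda>p. perm_subgraph p (verts G)) ` P)"
  proof (rule partition_onI)
    have "e \<in> (\<Union>p\<in>P. (\<lambda>v. arc_of v (p v)) ` verts G) \<longleftrightarrow> e \<in> arcs G" for e
      using mem ex1 arc_of_ends[of e] by (simp, metis)
    then show "\<Union> (arcs ` (\<lambda>p. perm_subgraph p (verts G)) ` P) = arcs G"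
      by auto
  next
    fix X Y
    assume "X \<in> arcs ` (\<lambda>p. perm_subgraph p (verts G)) ` P"
      "Y \<in> arcs ` (\<lambda>p. perm_subgraph p (verts G)) ` P" "X \<noteq> Y"
    then obtain p q where pq: "p \<in> P" "q \<in> P" "X = arcs (perm_subgraph p (verts G))"
      "Y = arcs (perm_subgraph q (verts G))" by blast
    with \<open>X \<noteq> Y\<close> have "p \<noteq> q" by blast
    note pq = pq[unfolded perm_subgraph_simps]
    have "False" if "e \<in> X" "e \<in> Y" for e
    proof -
      have e: "e \<in> arcs G" "p (tail G e) = head G e" "q (tail G e) = head G e"
        using that unfolding pq(3,4) mem[OF pq(1)] mem[OF pq(2)] by auto
      then show False
        using ex1[rule_format, OF arc_of_ends(1-3)[OF e(1)]] e(2,3) pq(1,2) \<open>p \<noteq> q\<close> by blast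
    qed
    then show "disjnt X Y" by (auto simp: disjnt_def)
  next
    have "verts G \<noteq> {}" if "p \<in> P" for p
      using P that unfolding factor_perm_def by auto
    then show "{} \<notin> arcs ` (\<lambda>p. perm_subgraph p (verts G)) ` P" by auto
  qed
  then have "cycle_factorization (replicate ((n - 3) div 2) 2 @ [3])
      ((\<lambda>p. perm_subgraph p (verts G)) ` P) G"
    unfolding cycle_factorization_def using P cycle_factor_perm_subgraph by auto
  then show ?thesis ..
qed

end

theorem theorem3p9:
  fixes n :: nat and G :: "('a,'b) pre_digraph"
  assumes "n \<ge> 5"
    and "n mod 8 = 1 \<or> n mod 8 = 3 \<or> n mod 8 = 7"
    and "complete_digraph n G"
  shows "\<exists>\<F>. cycle_factorization (replicate ((n - 3) div 2) 2 @ [3]) \<F> G"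
proof -
  interpret graph G using assms(3) by (simp add: complete_digraph_def)
  have "card (verts G) = n" using assms(3) by (simp add: complete_digraph_def)
  then have "factorizable (verts G)" using assms(1,2) by (intro factorizable_mod_8) auto
  then show ?thesis by (rule cycle_factorization_complete[OF assms(3)])
qed

end
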